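(* An ordered functor $P:\mathcal{A}\to\mathcal{X}$ between ordered categories is strongly order-solid if and only if it is order-solid and order-faithful. In this case, for any given ordered category $\mathcal{D}$: if $\mathcal{X}$ has all weighted limits of shape $\mathcal{D}$, so does $\mathcal{A}$.
   Context: $\mathcal{P}os$ is the category of partially ordered sets and monotone maps. An ordered category is a category whose hom-sets carry a partial order preserved by composition from either side; an ordered functor is a functor whose hom-maps are monotone. $\mathcal{P}os$ is ordered by the pointwise order of maps. For an ordered category $\mathcal{D}$, $\mathcal{D}^{\mathrm{op}}$ reverses arrows but keeps their order. Let $P:\mathcal{A}\to\mathcal{X}$ be an ordered functor. Order-faithful: $Pr\le Ps$ implies $r\le s$ for all $r,s:A\to B$ in $\mathcal{A}$. Strongly order-solid: for every (possibly empty, possibly proper-class-sized) family $D=(D_i)_{i\in I}$ of $\mathcal{A}$-objects and every family $\xi=(\xi_i:PD_i\to X)_{i\in I}$ in $\mathcal{X}$ there are a family $\alpha=(\alpha_i:D_i\to A)_{i\in I}$ in $\mathcal{A}$ and $q:X\to PA$ such that: 1. $P\alpha_i=q\cdot\xi_i$ for all $i$; 2. for every family $(\beta_i:D_i\to B)_{i\in I}$ in $\mathcal{A}$ and every $f:X\to PB$ with $P\beta_i=f\cdot\xi_i$ for all $i$ there is a unique $t:A\to B$ with $t\cdot\alpha_i=\beta_i$ for all $i$ and $Pt\cdot q=f$; 3. $q$ is order-$P$-epic: for all $r,s:A\to B$ in $\mathcal{A}$, $Pr\cdot q\le Ps\cdot q$ implies $r\le s$. Weighted cocones: an ordered diagram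 of shape $\mathcal{D}$ in $\mathcal{A}$ is an ordered functor $D:\mathcal{D}\to\mathcal{A}$, where $\mathcal{D}$ is an ordered category of unrestricted size. A weight is an ordered functor $W:\mathcal{D}^{\mathrm{op}}\to\mathcal{P}os$. A $W$-weighted cocone $\alpha:D\to A$ is a family of morphisms $\alpha_i^u:Di\to A$ ($i\in\mathrm{ob}\,\mathcal{D}$, $u\in Wi$) with $\alpha_i^u\le\alpha_i^v$ whenever $u\le v$ in $Wi$, and $\alpha_j^v\cdot Dd=\alpha_i^{Wd(v)}$ for all $d:i\to j$ in $\mathcal{D}$, $v\in Wj$. Equalities and inequalities involving cocones are meant componentwise. Order-universal $P$-extension of a $W$-weighted cocone $\xi:PD\to X$ in $\mathcal{X}$: a triple $(\alpha,A,q)$ with a $W$-weighted cocone $\alpha:D\to A$ in $\mathcal{A}$ and $q:X\to PA$ such that: 1. $q\cdot\xi=P\alpha$; 2. for every $W$-weighted cocone $\beta:D\to B$ in $\mathcal{A}$ and $f:X\to PB$ with $f\cdot\xi=P\beta$ there is a (unique) $t:A\to B$ with $t\cdot\alpha=\beta$ and $Pt\cdot q=f$; 3. for all $r,s:A\to B$ in $\mathcal{A}$, if $Pr\cdot q\le Ps\cdot q$ and $r\cdot\alpha\le s\cdot\alpha$, then $r\le s$. $P$ is order-solid if every weighted cocone $\xi:PD\to X$, for every ordered diagram $D:\mathcal{D}\to\mathcal{A}$ of any shape and any weight $W:\mathcal{D}^{\mathrm{op}}\to\mathcal{P}os$, has an order-universal $P$-extension. Weighted limits in $\mathcal{A}$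 are weighted colimits in $\mathcal{A}^{\mathrm{op}}$. Explicitly, for ordered functors $D:\mathcal{D}\to\mathcal{A}$ and $W:\mathcal{D}\to\mathcal{P}os$, a $W$-weighted limit of $D$ is a family $\lambda_i^u:L\to Di$ ($i\in\mathrm{ob}\,\mathcal{D}$, $u\in Wi$), monotone in $u$, with $Dd\cdot\lambda_i^u=\lambda_j^{Wd(u)}$ for all $d:i\to j$, $u\in Wi$, such that every other such family $\beta_i^u:B\to Di$ is $\beta_i^u=\lambda_i^u\cdot t$ for a unique $t:B\to L$, and such that for all $r,s:B\to L$, if $\lambda_i^u\cdot r\le\lambda_i^u\cdot s$ for all $i,u$, then $r\le s$. A category has all weighted limits of shape $\mathcal{D}$ if these exist for all such $D$ and $W$. *)

theory Defs
  imports "HOL-Library.FuncSet" "HOL-Library.Equipollence"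
begin

text \<open>
  Size conventions.  An infinite type \<open>'u\<close> serves as the universe: its subsets are the classes, and
  a class is a set iff it is not equinumerous with the universe (limitation of size).  The
  objects of an ordered category, its morphisms and the index families of the definitions below may
  form arbitrary, hence also proper, classes.  Hom-sets are not required to be small.  Only the
  posets that are objects of \<open>Pos\<close> are small.
\<close>

definition small :: "'u set \<Rightarrow> bool" where
  "small S \<longleftrightarrow> S \<prec> (UNIV :: 'u set)"


section \<open>Ordered categories and ordered functors\<close>

record ('o, 'm) ocat =
  Obj :: "'o set"
  Arr :: "'m set"
  Dom :: "'m \<Rightarrow> 'o"
  Cod :: "'m \<Rightarrow> 'o"
  Id :: "'o \<Rightarrow> 'm"
  Comp :: "'m \<Rightarrow> 'm \<Rightarrow> 'm"  (infixl "\<cdot>\<index>" 70)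
  Le :: "'m \<Rightarrow> 'm \<Rightarrow> bool"  (infix "\<sqsubseteq>\<index>" 50)

definition hom :: "('o, 'm) ocat \<Rightarrow> 'o \<Rightarrow> 'o \<Rightarrow> 'm set" where
  "hom C a b = {f \<in> Arr C. Dom C f = a \<and> Cod C f = b}"

text \<open>\<open>g \<cdot> f\<close> is \<open>g\<close> after \<open>f\<close>; composition and order only matter on composable
  and on parallel morphisms, respectively.\<close>

locale ordered_category =
  fixes C :: "('o, 'm) ocat" (structure)
  assumes dom_obj: "f \<in> Arr C \<Longrightarrow> Dom C f \<in> Obj C"
    and cod_obj: "f \<in> Arr C \<Longrightarrow> Cod C f \<in> Obj C"
    and id_hom: "a \<in> Obj C \<Longrightarrow> Id C a \<in> hom C a a"
    and comp_hom: "\<lbrakk>f \<in> hom C a b; g \<in> hom C b c\<rbrakk> \<Longrightarrow> g \<cdot> f \<in> hom C a c"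
    and comp_id: "f \<in> hom C a b \<Longrightarrow> f \<cdot> Id C a = f"
    and id_comp: "f \<in> hom C a b \<Longrightarrow> Id C b \<cdot> f = f"
    and comp_assoc: "\<lbrakk>f \<in> hom C a b; g \<in> hom C b c; h \<in> hom C c d\<rbrakk>
      \<Longrightarrow> h \<cdot> (g \<cdot> f) = (h \<cdot> g) \<cdot> f"
    and hom_order: "\<lbrakk>a \<in> Obj C; b \<in> Obj C\<rbrakk>
      \<Longrightarrow> partial_order_on (hom C a b) {(r, s). r \<in> hom C a b \<and> s \<in> hom C a b \<and> r \<sqsubseteq> s}"
    and comp_mono_left: "\<lbrakk>r \<in> hom C a b; s \<in> hom C a b; h \<in> hom C b c; r \<sqsubseteq> s\<rbrakk>
      \<Longrightarrow> h \<cdot> r \<sqsubseteq> h \<cdot> s"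
    and comp_mono_right: "\<lbrakk>k \<in> hom C a b; r \<in> hom C b c; s \<in> hom C b c; r \<sqsubseteq> s\<rbrakk>
      \<Longrightarrow> r \<cdot> k \<sqsubseteq> s \<cdot> k"

definition op_cat :: "('o, 'm) ocat \<Rightarrow> ('o, 'm) ocat" where
  "op_cat C = \<lparr>Obj = Obj C, Arr = Arr C, Dom = Cod C, Cod = Dom C, Id = Id C,
     Comp = (\<lambda>g f. f \<cdot>\<^bsub>C\<^esub> g), Le = Le C\<rparr>"

record ('o, 'm, 'p, 'n) ofun =
  fobj :: "'o \<Rightarrow> 'p"
  farr :: "'m \<Rightarrow> 'n"

locale ordered_functor =
  source: ordered_category A + target: ordered_category B
  for A :: "('o, 'm) ocat" and B :: "('p, 'n) ocat" and F :: "('o, 'm, 'p, 'n) ofun" +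
  assumes fobj_obj: "a \<in> Obj A \<Longrightarrow> fobj F a \<in> Obj B"
    and farr_hom: "f \<in> hom A a b \<Longrightarrow> farr F f \<in> hom B (fobj F a) (fobj F b)"
    and farr_id: "a \<in> Obj A \<Longrightarrow> farr F (Id A a) = Id B (fobj F a)"
    and farr_comp: "\<lbrakk>f \<in> hom A a b; g \<in> hom A b c\<rbrakk>
      \<Longrightarrow> farr F (g \<cdot>\<^bsub>A\<^esub> f) = farr F g \<cdot>\<^bsub>B\<^esub> farr F f"
    and farr_mono: "\<lbrakk>r \<in> hom A a b; s \<in> hom A a b; r \<sqsubseteq>\<^bsub>A\<^esub> s\<rbrakk> \<Longrightarrow> farr F r \<sqsubseteq>\<^bsub>B\<^esub> farr F s"

definition fcomp :: "('p, 'n, 'q, 'k) ofun \<Rightarrow> ('o, 'm, 'p, 'n) ofun \<Rightarrow> ('o, 'm, 'q, 'k) ofun"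
    (infixl "\<circ>\<^sub>F" 55) where
  "G \<circ>\<^sub>F F = \<lparr>fobj = fobj G \<circ> fobj F, farr = farr G \<circ> farr F\<rparr>"


section \<open>The ordered category of posets\<close>

record 'u poset =
  pcarrier :: "'u set"
  prel :: "('u \<times> 'u) set"

text \<open>Monotone maps carry their source and target; the underlying function is
  \<open>undefined\<close> outside the carrier of the source, so that equality of morphisms is equality of maps.\<close>

record 'u pmap =
  psource :: "'u poset"
  ptarget :: "'u poset"
  pfun :: "'u \<Rightarrow> 'u"

definition is_poset :: "'u poset \<Rightarrow> bool" where
  "is_poset Q \<longleftrightarrow> small (pcarrier Q) \<and> partial_order_on (pcarrier Q) (prel Q)"

definition is_pmap :: "'u pmap \<Rightarrow> bool" where
  "is_pmap m \<longleftrightarrow> is_poset (psource m) \<and> is_poset (ptarget m)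
     \<and> pfun m \<in> pcarrier (psource m) \<rightarrow>\<^sub>E pcarrier (ptarget m)
     \<and> monotone_on (pcarrier (psource m)) (\<lambda>u v. (u, v) \<in> prel (psource m))
         (\<lambda>u v. (u, v) \<in> prel (ptarget m)) (pfun m)"

definition Pos :: "('u poset, 'u pmap) ocat" where
  "Pos = \<lparr>Obj = Collect is_poset, Arr = Collect is_pmap, Dom = psource, Cod = ptarget,
     Id = (\<lambda>Q. \<lparr>psource = Q, ptarget = Q, pfun = (\<lambda>u \<in> pcarrier Q. u)\<rparr>),
     Comp = (\<lambda>g f. \<lparr>psource = psource f, ptarget = ptarget g,
       pfun = compose (pcarrier (psource f)) (pfun g) (pfun f)\<rparr>),
     Le = (\<lambda>f g. \<forall>u \<in> pcarrier (psource f). (pfun f u, pfun g u) \<in> prel (ptarget f))\<rparr>"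

lemma ordered_category_op:
  assumes "ordered_category C"
  shows "ordered_category (op_cat C)"
proof -
  interpret ordered_category C by fact
  have [simp]: "Obj (op_cat C) = Obj C" "Arr (op_cat C) = Arr C" "Dom (op_cat C) = Cod C"
    "Cod (op_cat C) = Dom C" "Id (op_cat C) = Id C" "Le (op_cat C) = Le C"
    "Comp (op_cat C) = (\<lambda>g f. f \<cdot>\<^bsub>C\<^esub> g)"
    by (simp_all add: op_cat_def)
  have [simp]: "hom (op_cat C) a b = hom C b a" for a b
    by (auto simp: hom_def)
  show ?thesis
    by unfold_locales
      (simp_all add: dom_obj cod_obj id_hom comp_hom comp_id id_comp comp_assoc hom_order
        comp_mono_left comp_mono_right)
qed

lemma ordered_category_Pos: "ordered_category (Pos :: ('u poset, 'u pmap) ocat)"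
proof
  fix a b :: "'u poset"
  assume "a \<in> Obj Pos" "b \<in> Obj Pos"
  then have po: "partial_order_on (pcarrier b) (prel b)"
    by (auto simp: Pos_def is_poset_def)
  let ?H = "hom Pos a b"
  let ?R = "{(r, s). r \<in> ?H \<and> s \<in> ?H \<and> r \<sqsubseteq>\<^bsub>Pos\<^esub> s}"
  have le: "(r, s) \<in> ?R \<longleftrightarrow>
      r \<in> ?H \<and> s \<in> ?H \<and> (\<forall>u \<in> pcarrier a. (pfun r u, pfun s u) \<in> prel b)" for r s
    by (auto simp: Pos_def hom_def)
  have H: "psource r = a \<and> ptarget r = b \<and> pfun r \<in> pcarrier a \<rightarrow>\<^sub>E pcarrier b" if "r \<in> ?H" for r
    using that by (auto simp: Pos_def hom_def is_pmap_def)
  have "refl_on ?H ?R"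
    using H partial_order_onD(1)[OF po] by (auto simp: refl_on_def le simp del: mem_Collect_eq)
  moreover have "trans ?R"
    using partial_order_onD(2)[OF po]
    by (intro transI) (unfold le, blast dest: transD)
  moreover have "antisym ?R"
  proof (rule antisymI)
    fix r s assume "(r, s) \<in> ?R" "(s, r) \<in> ?R"
    then have "r \<in> ?H" "s \<in> ?H" and "\<forall>u \<in> pcarrier a. pfun r u = pfun s u"
      using partial_order_onD(3)[OF po] unfolding le by (auto dest: antisymD)
    moreover from this have "pfun r = pfun s"
      using H by (intro PiE_ext[of "pfun r" "pcarrier a" "\<lambda>_. pcarrier b"]) auto
    ultimately show "r = s" using H by (intro pmap.equality) auto
  qed
  moreover have "?R \<subseteq> ?H \<times> ?H" by auto
  ultimately show "partial_order_on ?H ?R"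
    by (simp add: partial_order_on_def preorder_on_def)
qed (auto simp: Pos_def hom_def is_pmap_def monotone_on_def compose_def Id_compose compose_Id
      PiE_iff partial_order_onD is_poset_def extensional_def restrict_def fun_eq_iff
      intro!: pmap.equality)


section \<open>Order-faithful and strongly order-solid functors\<close>

definition order_faithful ::
    "('u, 'u) ocat \<Rightarrow> ('u, 'u) ocat \<Rightarrow> ('u, 'u, 'u, 'u) ofun \<Rightarrow> bool" where
  "order_faithful A X P \<longleftrightarrow>
     (\<forall>a \<in> Obj A. \<forall>b \<in> Obj A. \<forall>r \<in> hom A a b. \<forall>s \<in> hom A a b.
        farr P r \<sqsubseteq>\<^bsub>X\<^esub> farr P s \<longrightarrow> r \<sqsubseteq>\<^bsub>A\<^esub> s)"

definition order_P_epic ::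
    "('u, 'u) ocat \<Rightarrow> ('u, 'u) ocat \<Rightarrow> ('u, 'u, 'u, 'u) ofun \<Rightarrow> 'u \<Rightarrow> 'u \<Rightarrow> bool" where
  "order_P_epic A X P a q \<longleftrightarrow>
     (\<forall>b \<in> Obj A. \<forall>r \<in> hom A a b. \<forall>s \<in> hom A a b.
        farr P r \<cdot>\<^bsub>X\<^esub> q \<sqsubseteq>\<^bsub>X\<^esub> farr P s \<cdot>\<^bsub>X\<^esub> q \<longrightarrow> r \<sqsubseteq>\<^bsub>A\<^esub> s)"

definition strongly_order_solid ::
    "('u, 'u) ocat \<Rightarrow> ('u, 'u) ocat \<Rightarrow> ('u, 'u, 'u, 'u) ofun \<Rightarrow> bool" where
  "strongly_order_solid A X P \<longleftrightarrow>
     (\<forall>(I :: 'u set) D x \<xi>.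
        x \<in> Obj X \<longrightarrow> (\<forall>i \<in> I. D i \<in> Obj A \<and> \<xi> i \<in> hom X (fobj P (D i)) x) \<longrightarrow>
        (\<exists>a \<alpha> q. a \<in> Obj A \<and> (\<forall>i \<in> I. \<alpha> i \<in> hom A (D i) a) \<and> q \<in> hom X x (fobj P a)
          \<and> (\<forall>i \<in> I. farr P (\<alpha> i) = q \<cdot>\<^bsub>X\<^esub> \<xi> i)
          \<and> (\<forall>b \<beta> f. b \<in> Obj A \<longrightarrow> (\<forall>i \<in> I. \<beta> i \<in> hom A (D i) b) \<longrightarrow> f \<in> hom X x (fobj P b) \<longrightarrow>
               (\<forall>i \<in> I. farr P (\<beta> i) = f \<cdot>\<^bsub>X\<^esub> \<xi> i) \<longrightarrow>
               (\<exists>!t. t \<in> hom A a b \<and> (\<forall>i \<in> I. t \<cdot>\<^bsub>A\<^esub> \<alpha> i = \<beta> i) \<and> farr P t \<cdot>\<^bsub>X\<^esub> q = f))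
          \<and> order_P_epic A X P a q))"


section \<open>Weighted cocones and order-solid functors\<close>

text \<open>The component of a cocone \<open>\<alpha>\<close> at an object \<open>i\<close> and an element \<open>u\<close> of \<open>W i\<close> is
  \<open>\<alpha> i u\<close>; values at other arguments are irrelevant.\<close>

definition weighted_cocone ::
    "('o, 'm) ocat \<Rightarrow> ('s, 'd) ocat \<Rightarrow> ('s, 'd, 'o, 'm) ofun \<Rightarrow> ('s, 'd, 'u poset, 'u pmap) ofun
      \<Rightarrow> 'o \<Rightarrow> ('s \<Rightarrow> 'u \<Rightarrow> 'm) \<Rightarrow> bool" where
  "weighted_cocone C S D W a \<alpha> \<longleftrightarrow>
     a \<in> Obj C
     \<and> (\<forall>i \<in> Obj S. \<forall>u \<in> pcarrier (fobj W i). \<alpha> i u \<in> hom C (fobj D i) a)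
     \<and> (\<forall>i \<in> Obj S. \<forall>u v. (u, v) \<in> prel (fobj W i) \<longrightarrow> \<alpha> i u \<sqsubseteq>\<^bsub>C\<^esub> \<alpha> i v)
     \<and> (\<forall>i \<in> Obj S. \<forall>j \<in> Obj S. \<forall>d \<in> hom S i j. \<forall>v \<in> pcarrier (fobj W j).
          \<alpha> j v \<cdot>\<^bsub>C\<^esub> farr D d = \<alpha> i (pfun (farr W d) v))"

definition order_universal_extension ::
    "('u, 'u) ocat \<Rightarrow> ('u, 'u) ocat \<Rightarrow> ('u, 'u, 'u, 'u) ofun
      \<Rightarrow> ('u, 'u) ocat \<Rightarrow> ('u, 'u, 'u, 'u) ofun \<Rightarrow> ('u, 'u, 'u poset, 'u pmap) ofun
      \<Rightarrow> 'u \<Rightarrow> ('u \<Rightarrow> 'u \<Rightarrow> 'u) \<Rightarrow> ('u \<Rightarrow> 'u \<Rightarrow> 'u) \<Rightarrow> 'u \<Rightarrow> 'u \<Rightarrow> bool" where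
  "order_universal_extension A X P S D W x \<xi> \<alpha> a q \<longleftrightarrow>
     weighted_cocone A S D W a \<alpha> \<and> q \<in> hom X x (fobj P a)
     \<and> (\<forall>i \<in> Obj S. \<forall>u \<in> pcarrier (fobj W i). q \<cdot>\<^bsub>X\<^esub> \<xi> i u = farr P (\<alpha> i u))
     \<and> (\<forall>b \<beta> f. weighted_cocone A S D W b \<beta> \<longrightarrow> f \<in> hom X x (fobj P b) \<longrightarrow>
          (\<forall>i \<in> Obj S. \<forall>u \<in> pcarrier (fobj W i). f \<cdot>\<^bsub>X\<^esub> \<xi> i u = farr P (\<beta> i u)) \<longrightarrow>
          (\<exists>!t. t \<in> hom A a b
             \<and> (\<forall>i \<in> Obj S. \<forall>u \<in> pcarrier (fobj W i). t \<cdot>\<^bsub>A\<^esub> \<alpha> i u = \<beta> i u)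
             \<and> farr P t \<cdot>\<^bsub>X\<^esub> q = f))
     \<and> (\<forall>b \<in> Obj A. \<forall>r \<in> hom A a b. \<forall>s \<in> hom A a b.
          farr P r \<cdot>\<^bsub>X\<^esub> q \<sqsubseteq>\<^bsub>X\<^esub> farr P s \<cdot>\<^bsub>X\<^esub> q \<longrightarrow>
          (\<forall>i \<in> Obj S. \<forall>u \<in> pcarrier (fobj W i). r \<cdot>\<^bsub>A\<^esub> \<alpha> i u \<sqsubseteq>\<^bsub>A\<^esub> s \<cdot>\<^bsub>A\<^esub> \<alpha> i u) \<longrightarrow>
          r \<sqsubseteq>\<^bsub>A\<^esub> s)"

definition order_solid ::
    "('u, 'u) ocat \<Rightarrow> ('u, 'u) ocat \<Rightarrow> ('u, 'u, 'u, 'u) ofun \<Rightarrow> bool" where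
  "order_solid A X P \<longleftrightarrow>
     (\<forall>(S :: ('u, 'u) ocat) D (W :: ('u, 'u, 'u poset, 'u pmap) ofun) x \<xi>.
        ordered_functor S A D \<longrightarrow> ordered_functor (op_cat S) Pos W \<longrightarrow>
        weighted_cocone X S (P \<circ>\<^sub>F D) W x \<xi> \<longrightarrow>
        (\<exists>\<alpha> a q. order_universal_extension A X P S D W x \<xi> \<alpha> a q))"


section \<open>Weighted limits\<close>

definition weighted_cone ::
    "('o, 'm) ocat \<Rightarrow> ('s, 'd) ocat \<Rightarrow> ('s, 'd, 'o, 'm) ofun \<Rightarrow> ('s, 'd, 'u poset, 'u pmap) ofun
      \<Rightarrow> 'o \<Rightarrow> ('s \<Rightarrow> 'u \<Rightarrow> 'm) \<Rightarrow> bool" where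
  "weighted_cone C S D W l \<mu> \<longleftrightarrow>
     l \<in> Obj C
     \<and> (\<forall>i \<in> Obj S. \<forall>u \<in> pcarrier (fobj W i). \<mu> i u \<in> hom C l (fobj D i))
     \<and> (\<forall>i \<in> Obj S. \<forall>u v. (u, v) \<in> prel (fobj W i) \<longrightarrow> \<mu> i u \<sqsubseteq>\<^bsub>C\<^esub> \<mu> i v)
     \<and> (\<forall>i \<in> Obj S. \<forall>j \<in> Obj S. \<forall>d \<in> hom S i j. \<forall>u \<in> pcarrier (fobj W i).
          farr D d \<cdot>\<^bsub>C\<^esub> \<mu> i u = \<mu> j (pfun (farr W d) u))"

definition weighted_limit ::
    "('o, 'm) ocat \<Rightarrow> ('s, 'd) ocat \<Rightarrow> ('s, 'd, 'o, 'm) ofun \<Rightarrow> ('s, 'd, 'u poset, 'u pmap) ofun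
      \<Rightarrow> 'o \<Rightarrow> ('s \<Rightarrow> 'u \<Rightarrow> 'm) \<Rightarrow> bool" where
  "weighted_limit C S D W l \<mu> \<longleftrightarrow>
     weighted_cone C S D W l \<mu>
     \<and> (\<forall>b \<beta>. weighted_cone C S D W b \<beta> \<longrightarrow>
          (\<exists>!t. t \<in> hom C b l
             \<and> (\<forall>i \<in> Obj S. \<forall>u \<in> pcarrier (fobj W i). \<beta> i u = \<mu> i u \<cdot>\<^bsub>C\<^esub> t)))
     \<and> (\<forall>b \<in> Obj C. \<forall>r \<in> hom C b l. \<forall>s \<in> hom C b l.
          (\<forall>i \<in> Obj S. \<forall>u \<in> pcarrier (fobj W i). \<mu> i u \<cdot>\<^bsub>C\<^esub> r \<sqsubseteq>\<^bsub>C\<^esub> \<mu> i u \<cdot>\<^bsub>C\<^esub> s) \<longrightarrow>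
          r \<sqsubseteq>\<^bsub>C\<^esub> s)"

definition has_weighted_limits :: "('u, 'u) ocat \<Rightarrow> ('u, 'u) ocat \<Rightarrow> bool" where
  "has_weighted_limits C S \<longleftrightarrow>
     (\<forall>D (W :: ('u, 'u, 'u poset, 'u pmap) ofun).
        ordered_functor S C D \<longrightarrow> ordered_functor S Pos W \<longrightarrow>
        (\<exists>l \<mu>. weighted_limit C S D W l \<mu>))"

end

theory Submission
  imports Defs
begin

text \<open>
  A strongly order-solid functor \<open>P : A \<rightarrow> X\<close> is order-faithful because the lift \<open>e : B \<rightarrow> C\<close> of the
  sink consisting of the identity of \<open>PB\<close> has a retraction \<open>t\<close> while \<open>P e\<close> is
  order-\<open>P\<close>-epic: \<open>P r \<le> P s\<close> implies \<open>r \<cdot> t \<le> s \<cdot> t\<close>, and composing with \<open>e\<close> removes \<open>t\<close>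
  (\<open>strongly_order_solid_imp_order_faithful\<close>).

  Given faithfulness, a weighted cocone and a mere sink are nearly the same data.  All components
  \<open>\<xi>\<^sub>i\<^sup>u\<close> of a weighted cocone form a sink, and the inequalities and equations that make \<open>\<xi>\<close> a cocone
  are reflected to its lift (\<open>strongly_order_solid_imp_order_solid\<close>).  Conversely, a sink is a
  cocone on a discrete shape with one-point weights, and the third condition on an order-universal
  extension turns into the order-\<open>P\<close>-epic condition, as faithfulness derives
  \<open>r \<cdot> \<alpha> \<le> s \<cdot> \<alpha>\<close> from \<open>P r \<cdot> q \<le> P s \<cdot> q\<close>
  (\<open>order_solid_faithful_imp_strongly_order_solid\<close>).

  A limit of \<open>D\<close> in \<open>A\<close> is found by lifting the sink of all morphisms \<open>PB \<rightarrow> L\<close> into the limit \<open>L\<close>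
  of \<open>PD\<close> that come from cones over \<open>D\<close>; the lift \<open>L \<rightarrow> PK\<close> of this sink turns out to be an
  isomorphism (\<open>strongly_order_solid_lifts_weighted_limits\<close>).

  Size enters through the index families, which range over subsets of the universe.  The families
  used here are indexed by pairs, and an infinite universe contains a copy
  of the set of its pairs (\<open>pair_indexed_lift\<close>).
\<close>

section \<open>Preliminaries on ordered categories\<close>

context ordered_category
begin

lemma hom_objD:
  assumes "f \<in> hom C a b"
  shows "a \<in> Obj C" "b \<in> Obj C"
  using assms dom_obj cod_obj by (auto simp: hom_def)

lemma le_refl:
  assumes "f \<in> hom C a b"
  shows "f \<sqsubseteq> f"
proof -
  have "refl_on (hom C a b) {(r, s). r \<in> hom C a b \<and> s \<in> hom C a b \<and> r \<sqsubseteq> s}"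
    using hom_order[OF hom_objD[OF assms]] by (rule partial_order_onD(1))
  then show ?thesis using assms by (auto dest: refl_onD)
qed

lemma le_antisym:
  assumes "f \<in> hom C a b" "g \<in> hom C a b" "f \<sqsubseteq> g" "g \<sqsubseteq> f"
  shows "f = g"
proof -
  have "antisym {(r, s). r \<in> hom C a b \<and> s \<in> hom C a b \<and> r \<sqsubseteq> s}"
    using hom_order[OF hom_objD[OF assms(1)]] by (rule partial_order_onD(3))
  then show ?thesis using assms by (auto dest: antisymD)
qed

end

lemma ordered_functor_fcomp:
  assumes "ordered_functor A B F" "ordered_functor B C G"
  shows "ordered_functor A C (G \<circ>\<^sub>F F)"
proof -
  interpret F: ordered_functor A B F by fact
  interpret G: ordered_functor B C G by fact
  show ?thesis
    by unfold_locales
      (auto simp: fcomp_def F.fobj_obj G.fobj_obj F.farr_id G.farr_id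
        F.farr_comp G.farr_comp[OF F.farr_hom F.farr_hom]
        intro: F.farr_hom G.farr_hom G.farr_mono[OF F.farr_hom F.farr_hom] F.farr_mono)
qed

lemma ex_pairing:
  assumes "infinite (UNIV :: 'u set)"
  shows "\<exists>h :: 'u \<times> 'u \<Rightarrow> 'u. inj h"
proof -
  obtain h where "bij_betw h (UNIV \<times> UNIV :: ('u \<times> 'u) set) (UNIV :: 'u set)"
    using card_of_Times_same_infinite[OF assms] unfolding card_of_ordIso[symmetric] by blast
  then show ?thesis by (auto simp: bij_betw_def)
qed


section \<open>Lifts of sinks\<close>

text \<open>The index type is left open, because sinks indexed by pairs have to be lifted as well.\<close>

definition solid_lift ::
    "('u, 'u) ocat \<Rightarrow> ('u, 'u) ocat \<Rightarrow> ('u, 'u, 'u, 'u) ofun \<Rightarrow> 'u \<Rightarrow> 'i set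
      \<Rightarrow> ('i \<Rightarrow> 'u) \<Rightarrow> ('i \<Rightarrow> 'u) \<Rightarrow> 'u \<Rightarrow> ('i \<Rightarrow> 'u) \<Rightarrow> 'u \<Rightarrow> bool" where
  "solid_lift A X P x I D \<xi> a \<alpha> q \<longleftrightarrow>
     a \<in> Obj A \<and> (\<forall>i \<in> I. \<alpha> i \<in> hom A (D i) a) \<and> q \<in> hom X x (fobj P a)
     \<and> (\<forall>i \<in> I. farr P (\<alpha> i) = q \<cdot>\<^bsub>X\<^esub> \<xi> i)
     \<and> (\<forall>b \<beta> f. b \<in> Obj A \<longrightarrow> (\<forall>i \<in> I. \<beta> i \<in> hom A (D i) b) \<longrightarrow> f \<in> hom X x (fobj P b) \<longrightarrow>
          (\<forall>i \<in> I. farr P (\<beta> i) = f \<cdot>\<^bsub>X\<^esub> \<xi> i) \<longrightarrow>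
          (\<exists>!t. t \<in> hom A a b \<and> (\<forall>i \<in> I. t \<cdot>\<^bsub>A\<^esub> \<alpha> i = \<beta> i) \<and> farr P t \<cdot>\<^bsub>X\<^esub> q = f))
     \<and> order_P_epic A X P a q"

lemma strongly_order_solid_iff_lift:
  "strongly_order_solid A X P \<longleftrightarrow>
     (\<forall>(I :: 'u set) D x \<xi>. x \<in> Obj X \<longrightarrow>
        (\<forall>i \<in> I. D i \<in> Obj A \<and> \<xi> i \<in> hom X (fobj P (D i)) x) \<longrightarrow>
        (\<exists>a \<alpha> q. solid_lift A X P x I D \<xi> a \<alpha> q))"
  for A X :: "('u, 'u) ocat"
  unfolding strongly_order_solid_def solid_lift_def ..

lemma strongly_order_solid_lift:
  fixes I :: "'u set" and A X :: "('u, 'u) ocat"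
  assumes "strongly_order_solid A X P" "x \<in> Obj X"
    and "\<And>i. i \<in> I \<Longrightarrow> D i \<in> Obj A \<and> \<xi> i \<in> hom X (fobj P (D i)) x"
  obtains a \<alpha> q where "solid_lift A X P x I D \<xi> a \<alpha> q"
  using assms unfolding strongly_order_solid_iff_lift by metis

lemma solid_lift_reindex:
  assumes lift: "solid_lift A X P x (h ` J) D \<xi> a \<alpha> q" and h: "inj_on h J"
  shows "solid_lift A X P x J (D \<circ> h) (\<xi> \<circ> h) a (\<alpha> \<circ> h) q"
proof -
  have "\<exists>!t. t \<in> hom A a b \<and> (\<forall>j \<in> J. t \<cdot>\<^bsub>A\<^esub> \<alpha> (h j) = \<beta> j) \<and> farr P t \<cdot>\<^bsub>X\<^esub> q = f"
    if "b \<in> Obj A" "\<forall>j \<in> J. \<beta> j \<in> hom A (D (h j)) b" "f \<in> hom X x (fobj P b)"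
      "\<forall>j \<in> J. farr P (\<beta> j) = f \<cdot>\<^bsub>X\<^esub> \<xi> (h j)" for b \<beta> f
  proof -
    define \<beta>' where "\<beta>' = \<beta> \<circ> inv_into J h"
    have "\<beta>' (h j) = \<beta> j" if "j \<in> J" for j
      using that h by (simp add: \<beta>'_def)
    moreover have "(\<forall>k \<in> h ` J. \<beta>' k \<in> hom A (D k) b) \<longrightarrow>
        (\<forall>k \<in> h ` J. farr P (\<beta>' k) = f \<cdot>\<^bsub>X\<^esub> \<xi> k) \<longrightarrow>
        (\<exists>!t. t \<in> hom A a b \<and> (\<forall>k \<in> h ` J. t \<cdot>\<^bsub>A\<^esub> \<alpha> k = \<beta>' k) \<and> farr P t \<cdot>\<^bsub>X\<^esub> q = f)"
      using lift that(1,3) unfolding solid_lift_def by blast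
    ultimately show ?thesis
      using that(2,4) by simp
  qed
  then show ?thesis
    using lift by (simp add: solid_lift_def)
qed

locale class_functor = ordered_functor A X P
  for A X :: "('u, 'u) ocat" and P :: "('u, 'u, 'u, 'u) ofun"
begin

lemma faithful_le:
  assumes "order_faithful A X P" "r \<in> hom A a b" "s \<in> hom A a b"
    "farr P r \<sqsubseteq>\<^bsub>X\<^esub> farr P s"
  shows "r \<sqsubseteq>\<^bsub>A\<^esub> s"
  using assms source.hom_objD[OF assms(2)] unfolding order_faithful_def by blast

lemma faithful_eq:
  assumes "order_faithful A X P" "r \<in> hom A a b" "s \<in> hom A a b" "farr P r = farr P s"
  shows "r = s"
proof (rule source.le_antisym[OF assms(2,3)])
  have "farr P r \<sqsubseteq>\<^bsub>X\<^esub> farr P s" "farr P s \<sqsubseteq>\<^bsub>X\<^esub> farr P r"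
    using target.le_refl[OF farr_hom[OF assms(2)]] assms(4) by simp_all
  then show "r \<sqsubseteq>\<^bsub>A\<^esub> s" "s \<sqsubseteq>\<^bsub>A\<^esub> r"
    using faithful_le assms by blast+
qed

lemma epic_le:
  assumes "order_P_epic A X P a q" "r \<in> hom A a b" "s \<in> hom A a b"
    "farr P r \<cdot>\<^bsub>X\<^esub> q \<sqsubseteq>\<^bsub>X\<^esub> farr P s \<cdot>\<^bsub>X\<^esub> q"
  shows "r \<sqsubseteq>\<^bsub>A\<^esub> s"
  using assms source.hom_objD[OF assms(2)] unfolding order_P_epic_def by blast

lemma epic_eq:
  assumes "order_P_epic A X P a q" "q \<in> hom X x (fobj P a)" "r \<in> hom A a b" "s \<in> hom A a b"
    "farr P r \<cdot>\<^bsub>X\<^esub> q = farr P s \<cdot>\<^bsub>X\<^esub> q"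
  shows "r = s"
proof (rule source.le_antisym[OF assms(3,4)])
  have "farr P r \<cdot>\<^bsub>X\<^esub> q \<sqsubseteq>\<^bsub>X\<^esub> farr P s \<cdot>\<^bsub>X\<^esub> q" "farr P s \<cdot>\<^bsub>X\<^esub> q \<sqsubseteq>\<^bsub>X\<^esub> farr P r \<cdot>\<^bsub>X\<^esub> q"
    using target.le_refl[OF target.comp_hom[OF assms(2) farr_hom[OF assms(3)]]] assms(5)
    by simp_all
  then show "r \<sqsubseteq>\<^bsub>A\<^esub> s" "s \<sqsubseteq>\<^bsub>A\<^esub> r"
    using epic_le assms by blast+
qed

lemma farr_comp_assoc:
  assumes "f \<in> hom X x (fobj P a)" "r \<in> hom A a b" "s \<in> hom A b c"
  shows "farr P (s \<cdot>\<^bsub>A\<^esub> r) \<cdot>\<^bsub>X\<^esub> f = farr P s \<cdot>\<^bsub>X\<^esub> (farr P r \<cdot>\<^bsub>X\<^esub> f)"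
  using target.comp_assoc[OF assms(1) farr_hom[OF assms(2)] farr_hom[OF assms(3)]]
    farr_comp[OF assms(2,3)] by simp

lemma pair_indexed_lift:
  fixes J :: "('u \<times> 'u) set"
  assumes "infinite (UNIV :: 'u set)" and sos: "strongly_order_solid A X P" and x: "x \<in> Obj X"
    and sink: "\<And>j. j \<in> J \<Longrightarrow> D j \<in> Obj A \<and> \<xi> j \<in> hom X (fobj P (D j)) x"
  shows "\<exists>a \<alpha> q. solid_lift A X P x J D \<xi> a \<alpha> q"
proof -
  obtain h :: "'u \<times> 'u \<Rightarrow> 'u" where h: "inj h"
    using ex_pairing assms(1) by blast
  obtain a \<alpha> q where "solid_lift A X P x (h ` J) (D \<circ> inv h) (\<xi> \<circ> inv h) a \<alpha> q"
  proof (rule strongly_order_solid_lift[OF sos x])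
    show "(D \<circ> inv h) k \<in> Obj A \<and> (\<xi> \<circ> inv h) k \<in> hom X (fobj P ((D \<circ> inv h) k)) x"
      if k: "k \<in> h ` J" for k
    proof -
      obtain j where "j \<in> J" "k = h j"
        using k by blast
      then show ?thesis
        using sink h by simp
    qed
  qed
  from solid_lift_reindex[OF this inj_on_subset[OF h subset_UNIV]]
  show ?thesis
    using h by (auto simp: comp_assoc)
qed


section \<open>Strongly order-solid functors are order-faithful and order-solid\<close>

text \<open>Let \<open>e : b \<rightarrow> a\<close> with \<open>q = P e\<close> be the lift of the sink \<open>id : Pb \<rightarrow> Pb\<close>.  Its universal property
  at \<open>id\<close> yields \<open>t : a \<rightarrow> b\<close> with \<open>t \<cdot> e = id\<close> and \<open>P t \<cdot> q = id\<close>.  From \<open>P r \<le> P s\<close> one obtains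
  \<open>P (r \<cdot> t) \<cdot> q \<le> P (s \<cdot> t) \<cdot> q\<close>, hence \<open>r \<cdot> t \<le> s \<cdot> t\<close>, and composing with \<open>e\<close> gives \<open>r \<le> s\<close>.\<close>

lemma strongly_order_solid_imp_order_faithful:
  assumes "strongly_order_solid A X P"
  shows "order_faithful A X P"
  unfolding order_faithful_def
proof (intro ballI impI)
  fix b c r s
  assume b: "b \<in> Obj A" and rs: "r \<in> hom A b c" "s \<in> hom A b c"
    and le: "farr P r \<sqsubseteq>\<^bsub>X\<^esub> farr P s"
  let ?D = "\<lambda>_ :: 'u. b" and ?\<xi> = "\<lambda>_ :: 'u. Id X (fobj P b)"
  have Pb: "fobj P b \<in> Obj X" and id: "Id X (fobj P b) \<in> hom X (fobj P b) (fobj P b)"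
    using b fobj_obj target.id_hom by blast+
  then obtain a \<alpha> q where lift: "solid_lift A X P (fobj P b) {undefined} ?D ?\<xi> a \<alpha> q"
    using strongly_order_solid_lift[OF assms, of "fobj P b" "{undefined}" ?D ?\<xi>] b by auto
  define e where "e = \<alpha> undefined"
  have a: "a \<in> Obj A" and e: "e \<in> hom A b a" and q: "q \<in> hom X (fobj P b) (fobj P a)"
    and Pe: "farr P e = q \<cdot>\<^bsub>X\<^esub> Id X (fobj P b)"
    and epic: "order_P_epic A X P a q"
    using lift by (simp_all add: solid_lift_def e_def)
  have univ: "\<exists>!t. t \<in> hom A a b' \<and> t \<cdot>\<^bsub>A\<^esub> e = g \<and> farr P t \<cdot>\<^bsub>X\<^esub> q = f"
    if "b' \<in> Obj A" "g \<in> hom A b b'" "f \<in> hom X (fobj P b) (fobj P b')"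
      "farr P g = f \<cdot>\<^bsub>X\<^esub> Id X (fobj P b)" for b' g f
    using lift that unfolding solid_lift_def e_def
    by (elim conjE allE[of _ b'] allE[of _ "\<lambda>_. g"] allE[of _ f]) simp
  obtain t where t: "t \<in> hom A a b" and te: "t \<cdot>\<^bsub>A\<^esub> e = Id A b"
      and tq: "farr P t \<cdot>\<^bsub>X\<^esub> q = Id X (fobj P b)"
    using univ[of b "Id A b" "Id X (fobj P b)"] b id source.id_hom[OF b]
      farr_id[OF b] target.comp_id[OF id] by auto
  have cancel: "farr P (g \<cdot>\<^bsub>A\<^esub> t) \<cdot>\<^bsub>X\<^esub> q = farr P g" "(g \<cdot>\<^bsub>A\<^esub> t) \<cdot>\<^bsub>A\<^esub> e = g"
    if g: "g \<in> hom A b c" for g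
    using farr_comp_assoc[OF q t g] tq target.comp_id[OF farr_hom[OF g]]
      source.comp_assoc[OF e t g] te source.comp_id[OF g] by simp_all
  have rt: "r \<cdot>\<^bsub>A\<^esub> t \<in> hom A a c" "s \<cdot>\<^bsub>A\<^esub> t \<in> hom A a c"
    using source.comp_hom[OF t] rs by blast+
  have "r \<cdot>\<^bsub>A\<^esub> t \<sqsubseteq>\<^bsub>A\<^esub> s \<cdot>\<^bsub>A\<^esub> t"
    using epic_le[OF epic rt] cancel rs le by simp
  then have "(r \<cdot>\<^bsub>A\<^esub> t) \<cdot>\<^bsub>A\<^esub> e \<sqsubseteq>\<^bsub>A\<^esub> (s \<cdot>\<^bsub>A\<^esub> t) \<cdot>\<^bsub>A\<^esub> e"
    using source.comp_mono_right[OF e rt] by blast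
  then show "r \<sqsubseteq>\<^bsub>A\<^esub> s"
    using cancel rs by simp
qed

text \<open>The lift of the sink of all components of the cocone, indexed by the pairs \<open>(i, u)\<close>, is the
  extension.\<close>

lemma strongly_order_solid_imp_order_solid:
  assumes inf: "infinite (UNIV :: 'u set)" and sos: "strongly_order_solid A X P"
  shows "order_solid A X P"
  unfolding order_solid_def
proof (intro allI impI)
  fix S :: "('u, 'u) ocat" and D and W :: "('u, 'u, 'u poset, 'u pmap) ofun" and x \<xi>
  assume DF: "ordered_functor S A D" and WF: "ordered_functor (op_cat S) Pos W"
    and \<xi>: "weighted_cocone X S (P \<circ>\<^sub>F D) W x \<xi>"
  interpret D: ordered_functor S A D by fact
  interpret W: ordered_functor "op_cat S" Pos W by fact
  have faithful: "order_faithful A X P"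
    using sos by (rule strongly_order_solid_imp_order_faithful)
  have x: "x \<in> Obj X"
    and \<xi>_hom: "\<And>i u. i \<in> Obj S \<Longrightarrow> u \<in> pcarrier (fobj W i) \<Longrightarrow> \<xi> i u \<in> hom X (fobj P (fobj D i)) x"
    and \<xi>_mono: "\<And>i u v. i \<in> Obj S \<Longrightarrow> (u, v) \<in> prel (fobj W i) \<Longrightarrow> \<xi> i u \<sqsubseteq>\<^bsub>X\<^esub> \<xi> i v"
    and \<xi>_nat: "\<And>i j d v. i \<in> Obj S \<Longrightarrow> j \<in> Obj S \<Longrightarrow> d \<in> hom S i j \<Longrightarrow> v \<in> pcarrier (fobj W j) \<Longrightarrow>
        \<xi> j v \<cdot>\<^bsub>X\<^esub> farr P (farr D d) = \<xi> i (pfun (farr W d) v)"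
    using \<xi> by (auto simp: weighted_cocone_def fcomp_def)
  define J where "J = {(i, u). i \<in> Obj S \<and> u \<in> pcarrier (fobj W i)}"
  have ball_J: "(\<forall>j \<in> J. R j) \<longleftrightarrow> (\<forall>i \<in> Obj S. \<forall>u \<in> pcarrier (fobj W i). R (i, u))" for R
    by (auto simp: J_def)
  obtain a \<alpha> q where lift: "solid_lift A X P x J (\<lambda>(i, u). fobj D i) (\<lambda>(i, u). \<xi> i u) a \<alpha> q"
    using pair_indexed_lift[OF inf sos x, of J "\<lambda>(i, u). fobj D i" "\<lambda>(i, u). \<xi> i u"]
      \<xi>_hom D.fobj_obj by (auto simp: J_def)
  have a: "a \<in> Obj A"
    and \<alpha>_hom: "\<And>i u. i \<in> Obj S \<Longrightarrow> u \<in> pcarrier (fobj W i) \<Longrightarrow> \<alpha> (i, u) \<in> hom A (fobj D i) a"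
    and q: "q \<in> hom X x (fobj P a)"
    and P\<alpha>: "\<And>i u. i \<in> Obj S \<Longrightarrow> u \<in> pcarrier (fobj W i) \<Longrightarrow> farr P (\<alpha> (i, u)) = q \<cdot>\<^bsub>X\<^esub> \<xi> i u"
    and epic: "order_P_epic A X P a q"
    using lift by (simp_all add: solid_lift_def ball_J)
  have carrier: "u \<in> pcarrier (fobj W i)" "v \<in> pcarrier (fobj W i)"
    if "i \<in> Obj S" "(u, v) \<in> prel (fobj W i)" for i u v
  proof -
    have "is_poset (fobj W i)"
      using W.fobj_obj[of i] that(1) by (simp add: op_cat_def Pos_def)
    then show "u \<in> pcarrier (fobj W i)" "v \<in> pcarrier (fobj W i)"
      using that(2) by (auto simp: is_poset_def partial_order_on_def preorder_on_def)
  qed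
  have W_app: "pfun (farr W d) v \<in> pcarrier (fobj W i)"
    if "d \<in> hom S i j" "v \<in> pcarrier (fobj W j)" for d i j v
  proof -
    have "farr W d \<in> hom Pos (fobj W j) (fobj W i)"
      using W.farr_hom[of d j i] that(1) by (auto simp: op_cat_def hom_def)
    then show ?thesis
      using that(2) by (auto simp: Pos_def hom_def is_pmap_def)
  qed
  \<comment> \<open>Faithfulness reflects the relations between the components of \<open>\<xi>\<close> to those of \<open>\<alpha>\<close>.\<close>
  have cocone: "weighted_cocone A S D W a (\<lambda>i u. \<alpha> (i, u))"
    unfolding weighted_cocone_def
  proof (intro conjI ballI allI impI)
    show "a \<in> Obj A" by (fact a)
    show "\<alpha> (i, u) \<in> hom A (fobj D i) a" if "i \<in> Obj S" "u \<in> pcarrier (fobj W i)" for i u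
      using that by (rule \<alpha>_hom)
    show "\<alpha> (i, u) \<sqsubseteq>\<^bsub>A\<^esub> \<alpha> (i, v)" if i: "i \<in> Obj S" and uv: "(u, v) \<in> prel (fobj W i)" for i u v
    proof (rule faithful_le[OF faithful])
      show "\<alpha> (i, u) \<in> hom A (fobj D i) a" "\<alpha> (i, v) \<in> hom A (fobj D i) a"
        using carrier[OF i uv] \<alpha>_hom[OF i] by blast+
      have "q \<cdot>\<^bsub>X\<^esub> \<xi> i u \<sqsubseteq>\<^bsub>X\<^esub> q \<cdot>\<^bsub>X\<^esub> \<xi> i v"
        using carrier[OF i uv] \<xi>_hom[OF i] \<xi>_mono[OF i uv] q by (blast intro: target.comp_mono_left)
      then show "farr P (\<alpha> (i, u)) \<sqsubseteq>\<^bsub>X\<^esub> farr P (\<alpha> (i, v))"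
        using P\<alpha>[OF i] carrier[OF i uv] by simp
    qed
    show "\<alpha> (j, v) \<cdot>\<^bsub>A\<^esub> farr D d = \<alpha> (i, pfun (farr W d) v)"
      if i: "i \<in> Obj S" and j: "j \<in> Obj S" and d: "d \<in> hom S i j" and v: "v \<in> pcarrier (fobj W j)"
      for i j d v
    proof (rule faithful_eq[OF faithful])
      note Dd = D.farr_hom[OF d]
      show "\<alpha> (j, v) \<cdot>\<^bsub>A\<^esub> farr D d \<in> hom A (fobj D i) a"
        using source.comp_hom[OF Dd \<alpha>_hom[OF j v]] .
      show "\<alpha> (i, pfun (farr W d) v) \<in> hom A (fobj D i) a"
        using \<alpha>_hom[OF i W_app[OF d v]] .
      show "farr P (\<alpha> (j, v) \<cdot>\<^bsub>A\<^esub> farr D d) = farr P (\<alpha> (i, pfun (farr W d) v))"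
        using farr_comp[OF Dd \<alpha>_hom[OF j v]] P\<alpha>[OF j v] P\<alpha>[OF i W_app[OF d v]]
          target.comp_assoc[OF farr_hom[OF Dd] \<xi>_hom[OF j v] q] \<xi>_nat[OF i j d v] by simp
    qed
  qed
  have univ': "\<exists>!t. t \<in> hom A a b
        \<and> (\<forall>i \<in> Obj S. \<forall>u \<in> pcarrier (fobj W i). t \<cdot>\<^bsub>A\<^esub> \<alpha> (i, u) = \<beta> i u) \<and> farr P t \<cdot>\<^bsub>X\<^esub> q = f"
    if "weighted_cocone A S D W b \<beta>" "f \<in> hom X x (fobj P b)"
      "\<forall>i \<in> Obj S. \<forall>u \<in> pcarrier (fobj W i). f \<cdot>\<^bsub>X\<^esub> \<xi> i u = farr P (\<beta> i u)" for b \<beta> f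
  proof -
    have "b \<in> Obj A" "\<forall>i \<in> Obj S. \<forall>u \<in> pcarrier (fobj W i). \<beta> i u \<in> hom A (fobj D i) b"
      using that(1) unfolding weighted_cocone_def by blast+
    then show ?thesis
      using lift that(2,3) unfolding solid_lift_def ball_J
      by (elim conjE allE[of _ b] allE[of _ "\<lambda>(i, u). \<beta> i u"] allE[of _ f]) simp
  qed
  have "order_universal_extension A X P S D W x \<xi> (\<lambda>i u. \<alpha> (i, u)) a q"
    unfolding order_universal_extension_def
    by (intro conjI ballI allI impI;
        (fact cocone q | rule univ' P\<alpha>[symmetric] epic_le[OF epic]; assumption))
  then show "\<exists>\<alpha> a q. order_universal_extension A X P S D W x \<xi> \<alpha> a q" by blast
qed

end


section \<open>Order-solid order-faithful functors are strongly order-solid\<close>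

definition discrete_cat :: "'o set \<Rightarrow> ('o, 'o) ocat" where
  "discrete_cat I = \<lparr>Obj = I, Arr = I, Dom = id, Cod = id, Id = id, Comp = (\<lambda>g f. f), Le = (=)\<rparr>"

lemma hom_discrete_cat: "hom (discrete_cat I) i j = {k \<in> I. k = i \<and> k = j}"
  by (auto simp: hom_def discrete_cat_def)

lemma ordered_category_discrete_cat: "ordered_category (discrete_cat I)"
  by unfold_locales
    (auto simp: hom_discrete_cat, auto simp: discrete_cat_def partial_order_on_def preorder_on_def
      refl_on_def trans_def antisym_def)

lemma ordered_functor_discrete_cat:
  assumes "ordered_category A" "\<And>i. i \<in> I \<Longrightarrow> D i \<in> Obj A"
  shows "ordered_functor (discrete_cat I) A \<lparr>fobj = D, farr = (\<lambda>i. Id A (D i))\<rparr>"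
proof -
  interpret A: ordered_category A by fact
  interpret I: ordered_category "discrete_cat I" by (rule ordered_category_discrete_cat)
  have id: "Id A (D i) \<in> hom A (D i) (D i)" if "i \<in> I" for i
    using A.id_hom assms(2) that by blast
  show ?thesis
    by unfold_locales
      (use assms(2) id A.comp_id[OF id] A.le_refl[OF id] in
        \<open>auto simp: hom_discrete_cat, auto simp: discrete_cat_def\<close>)
qed

lemma ordered_functor_const:
  assumes "ordered_category S" "ordered_category C" "c \<in> Obj C"
  shows "ordered_functor S C \<lparr>fobj = (\<lambda>_. c), farr = (\<lambda>_. Id C c)\<rparr>"
proof -
  interpret S: ordered_category S by fact
  interpret C: ordered_category C by fact
  have "Id C c \<in> hom C c c"
    using assms(3) by (rule C.id_hom)
  then show ?thesis
    by unfold_locales (auto simp: assms(3) C.comp_id intro: C.le_refl)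
qed

definition point :: "'u poset" where
  "point = \<lparr>pcarrier = {undefined}, prel = {(undefined, undefined)}\<rparr>"

lemma point_simps [simp]:
  "pcarrier point = {undefined}" "(u, v) \<in> prel point \<longleftrightarrow> u = undefined \<and> v = undefined"
  by (simp_all add: point_def)

lemma point_in_Pos:
  assumes "infinite (UNIV :: 'u set)"
  shows "(point :: 'u poset) \<in> Obj Pos"
proof -
  have "small {undefined :: 'u}"
    using assms by (simp add: small_def finite_lesspoll_infinite)
  then show ?thesis
    by (simp add: Pos_def is_poset_def point_def partial_order_on_def preorder_on_def
        refl_on_def trans_def antisym_def)
qed

lemma (in class_functor) order_solid_faithful_imp_strongly_order_solid:
  assumes inf: "infinite (UNIV :: 'u set)"
    and solid: "order_solid A X P" and faithful: "order_faithful A X P"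
  shows "strongly_order_solid A X P"
  unfolding strongly_order_solid_iff_lift
proof (intro allI impI)
  fix I :: "'u set" and D x \<xi>
  assume x: "x \<in> Obj X"
    and sink: "\<forall>i \<in> I. D i \<in> Obj A \<and> \<xi> i \<in> hom X (fobj P (D i)) x"
  let ?S = "discrete_cat I"
  let ?D = "\<lparr>fobj = D, farr = (\<lambda>i. Id A (D i))\<rparr>"
  let ?W = "\<lparr>fobj = (\<lambda>_. point), farr = (\<lambda>_. Id Pos point)\<rparr>
      :: ('u, 'u, 'u poset, 'u pmap) ofun"
  have D: "ordered_functor ?S A ?D"
    by (rule ordered_functor_discrete_cat[OF source.ordered_category_axioms]) (use sink in blast)
  have W: "ordered_functor (op_cat ?S) Pos ?W"
    by (rule ordered_functor_const[OF ordered_category_op[OF ordered_category_discrete_cat]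
          ordered_category_Pos point_in_Pos[OF inf]])
  have Obj_S: "Obj ?S = I"
    by (simp add: discrete_cat_def)
  have Id_point: "pfun (Id Pos point) undefined = (undefined :: 'u)"
    by (simp add: Pos_def)
  \<comment> \<open>A cocone of this shape and weight is just a sink, as the shape has only identities and the
      weight only reflexive relations.\<close>
  have cocone_iff: "weighted_cocone C ?S F ?W b \<beta> \<longleftrightarrow>
      b \<in> Obj C \<and> (\<forall>i \<in> I. \<beta> i undefined \<in> hom C (fobj F i) b)"
    if "ordered_functor ?S C F" for C :: "('u, 'u) ocat" and F b and \<beta> :: "'u \<Rightarrow> 'u \<Rightarrow> 'u"
  proof -
    interpret F: ordered_functor ?S C F by fact
    have "farr F i = Id C (fobj F i)" if "i \<in> I" for i
      using F.farr_id[of i] that by (simp add: discrete_cat_def)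
    then show ?thesis
      unfolding weighted_cocone_def Obj_S
      by (auto simp: Id_point hom_discrete_cat F.target.comp_id intro: F.target.le_refl)
  qed
  have "weighted_cocone X ?S (P \<circ>\<^sub>F ?D) ?W x (\<lambda>i _. \<xi> i)"
    using cocone_iff[OF ordered_functor_fcomp[OF D ordered_functor_axioms]] x sink
    by (simp add: fcomp_def)
  then obtain \<alpha> a q where
      ext: "order_universal_extension A X P ?S ?D ?W x (\<lambda>i _. \<xi> i) \<alpha> a q"
    using solid D W unfolding order_solid_def by blast
  have \<alpha>: "\<alpha> i undefined \<in> hom A (D i) a" if "i \<in> I" for i
    using ext that by (simp add: order_universal_extension_def cocone_iff[OF D])
  have P\<alpha>: "farr P (\<alpha> i undefined) = q \<cdot>\<^bsub>X\<^esub> \<xi> i" if "i \<in> I" for i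
    using ext that by (simp add: order_universal_extension_def Obj_S)
  have q: "q \<in> hom X x (fobj P a)"
    using ext by (simp add: order_universal_extension_def)
  \<comment> \<open>Faithfulness derives the premise \<open>r \<cdot> \<alpha> \<le> s \<cdot> \<alpha>\<close> of the extension from \<open>P r \<cdot> q \<le> P s \<cdot> q\<close>,
      as \<open>P (r \<cdot> \<alpha>) = P r \<cdot> q \<cdot> \<xi>\<close>.\<close>
  have epic: "order_P_epic A X P a q"
    unfolding order_P_epic_def
  proof (intro ballI impI)
    fix b r s
    assume b: "b \<in> Obj A" and r: "r \<in> hom A a b" and s: "s \<in> hom A a b"
      and le: "farr P r \<cdot>\<^bsub>X\<^esub> q \<sqsubseteq>\<^bsub>X\<^esub> farr P s \<cdot>\<^bsub>X\<^esub> q"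
    have "r \<cdot>\<^bsub>A\<^esub> \<alpha> i undefined \<sqsubseteq>\<^bsub>A\<^esub> s \<cdot>\<^bsub>A\<^esub> \<alpha> i undefined" if i: "i \<in> I" for i
    proof (rule faithful_le[OF faithful])
      show "r \<cdot>\<^bsub>A\<^esub> \<alpha> i undefined \<in> hom A (D i) b" "s \<cdot>\<^bsub>A\<^esub> \<alpha> i undefined \<in> hom A (D i) b"
        using source.comp_hom[OF \<alpha>[OF i]] r s by blast+
      have \<xi>i: "\<xi> i \<in> hom X (fobj P (D i)) x"
        using sink i by blast
      have "farr P (g \<cdot>\<^bsub>A\<^esub> \<alpha> i undefined) = (farr P g \<cdot>\<^bsub>X\<^esub> q) \<cdot>\<^bsub>X\<^esub> \<xi> i" if "g \<in> hom A a b" for g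
        using farr_comp[OF \<alpha>[OF i] that] P\<alpha>[OF i] target.comp_assoc[OF \<xi>i q farr_hom[OF that]]
        by simp
      then show "farr P (r \<cdot>\<^bsub>A\<^esub> \<alpha> i undefined) \<sqsubseteq>\<^bsub>X\<^esub> farr P (s \<cdot>\<^bsub>A\<^esub> \<alpha> i undefined)"
        using target.comp_mono_right[OF \<xi>i target.comp_hom[OF q farr_hom[OF r]]
            target.comp_hom[OF q farr_hom[OF s]] le] r s by simp
    qed
    then show "r \<sqsubseteq>\<^bsub>A\<^esub> s"
      using ext b r s le by (simp add: order_universal_extension_def Obj_S)
  qed
  have "\<exists>!t. t \<in> hom A a b \<and> (\<forall>i \<in> I. t \<cdot>\<^bsub>A\<^esub> \<alpha> i undefined = \<beta> i) \<and> farr P t \<cdot>\<^bsub>X\<^esub> q = f"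
    if "b \<in> Obj A" "\<forall>i \<in> I. \<beta> i \<in> hom A (D i) b" "f \<in> hom X x (fobj P b)"
      "\<forall>i \<in> I. farr P (\<beta> i) = f \<cdot>\<^bsub>X\<^esub> \<xi> i" for b \<beta> f
  proof -
    have "weighted_cocone A ?S ?D ?W b (\<lambda>i _. \<beta> i)"
      using that(1,2) by (simp add: cocone_iff[OF D])
    then show ?thesis
      using ext that(3,4) unfolding order_universal_extension_def Obj_S
      by (elim conjE allE[of _ b] allE[of _ "\<lambda>i _. \<beta> i"] allE[of _ f]) simp
  qed
  then have "solid_lift A X P x I D \<xi> a (\<lambda>i. \<alpha> i undefined) q"
    unfolding solid_lift_def
    using \<alpha> P\<alpha> q epic ext by (simp add: order_universal_extension_def cocone_iff[OF D])
  then show "\<exists>a \<alpha> q. solid_lift A X P x I D \<xi> a \<alpha> q" by blast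
qed


section \<open>Lifting weighted limits\<close>

text \<open>Let \<open>\<lambda> : L \<rightarrow> PD\<close> be a weighted limit in \<open>X\<close>.  The sink to be lifted consists of all
  \<open>g : PB \<rightarrow> L\<close> that come from a cone over \<open>D\<close> with vertex \<open>B\<close>.  Indexing it by the cones themselves
  would leave the universe, since a cone is a whole family of morphisms; the pairs \<open>(B, g)\<close> suffice,
  because by faithfulness \<open>g\<close> determines the cone.  The lift \<open>q : L \<rightarrow> PK\<close> carries a cone \<open>\<mu>\<close> with
  \<open>P \<mu> \<cdot> q = \<lambda>\<close>, and the morphism \<open>p : PK \<rightarrow> L\<close> induced by \<open>P \<mu>\<close> is left inverse to \<open>q\<close>.  Since
  \<open>(K, p)\<close> is itself one of the indices, \<open>p\<close> is even an inverse, so that \<open>P \<mu>\<close> is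
  a limit in \<open>X\<close>.  Faithfulness then reflects the order condition to \<open>\<mu>\<close>, and a cone with index
  \<open>(B, g)\<close> factors through \<open>\<mu>\<close> by the component \<open>\<alpha> (B, g)\<close> of the lift.\<close>

lemma (in class_functor) strongly_order_solid_lifts_weighted_limits:
  assumes inf: "infinite (UNIV :: 'u set)" and sos: "strongly_order_solid A X P"
    and X_limits: "has_weighted_limits X (S :: ('u, 'u) ocat)"
  shows "has_weighted_limits A S"
  unfolding has_weighted_limits_def
proof (intro allI impI)
  fix D and W :: "('u, 'u, 'u poset, 'u pmap) ofun"
  assume DF: "ordered_functor S A D" and WF: "ordered_functor S Pos W"
  interpret D: ordered_functor S A D by fact
  interpret W: ordered_functor S Pos W by fact
  have faithful: "order_faithful A X P"
    using sos by (rule strongly_order_solid_imp_order_faithful)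
  obtain l \<mu>X where lim: "weighted_limit X S (P \<circ>\<^sub>F D) W l \<mu>X"
    using X_limits ordered_functor_fcomp[OF DF ordered_functor_axioms] WF
    unfolding has_weighted_limits_def by blast
  have l: "l \<in> Obj X"
    and \<mu>X_hom: "\<And>i u. i \<in> Obj S \<Longrightarrow> u \<in> pcarrier (fobj W i) \<Longrightarrow> \<mu>X i u \<in> hom X l (fobj P (fobj D i))"
    and \<mu>X_mono: "\<And>i u v. i \<in> Obj S \<Longrightarrow> (u, v) \<in> prel (fobj W i) \<Longrightarrow> \<mu>X i u \<sqsubseteq>\<^bsub>X\<^esub> \<mu>X i v"
    and \<mu>X_nat: "\<And>i j d u. i \<in> Obj S \<Longrightarrow> j \<in> Obj S \<Longrightarrow> d \<in> hom S i j \<Longrightarrow> u \<in> pcarrier (fobj W i) \<Longrightarrow>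
        farr P (farr D d) \<cdot>\<^bsub>X\<^esub> \<mu>X i u = \<mu>X j (pfun (farr W d) u)"
    using lim by (auto simp: weighted_limit_def weighted_cone_def fcomp_def)
  have lim_ex: "\<exists>t. t \<in> hom X b l \<and>
      (\<forall>i \<in> Obj S. \<forall>u \<in> pcarrier (fobj W i). \<beta> i u = \<mu>X i u \<cdot>\<^bsub>X\<^esub> t)"
    if "weighted_cone X S (P \<circ>\<^sub>F D) W b \<beta>" for b \<beta>
    using lim that unfolding weighted_limit_def by blast
  have lim_le: "r \<sqsubseteq>\<^bsub>X\<^esub> s"
    if "r \<in> hom X b l" "s \<in> hom X b l"
      "\<And>i u. i \<in> Obj S \<Longrightarrow> u \<in> pcarrier (fobj W i) \<Longrightarrow> \<mu>X i u \<cdot>\<^bsub>X\<^esub> r \<sqsubseteq>\<^bsub>X\<^esub> \<mu>X i u \<cdot>\<^bsub>X\<^esub> s" for b r s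
    using lim that target.hom_objD[OF that(1)] unfolding weighted_limit_def by blast
  have lim_eq: "r = s"
    if rs: "r \<in> hom X b l" "s \<in> hom X b l"
      and eq: "\<And>i u. i \<in> Obj S \<Longrightarrow> u \<in> pcarrier (fobj W i) \<Longrightarrow> \<mu>X i u \<cdot>\<^bsub>X\<^esub> r = \<mu>X i u \<cdot>\<^bsub>X\<^esub> s" for b r s
    by (rule target.le_antisym[OF rs]; rule lim_le; (rule rs)?)
      (use eq target.le_refl[OF target.comp_hom[OF _ \<mu>X_hom]] rs in \<open>metis\<close>)+
  have carrier: "u \<in> pcarrier (fobj W i)" "v \<in> pcarrier (fobj W i)"
    if "i \<in> Obj S" "(u, v) \<in> prel (fobj W i)" for i u v
  proof -
    have "is_poset (fobj W i)"
      using W.fobj_obj[OF that(1)] by (simp add: Pos_def)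
    then show "u \<in> pcarrier (fobj W i)" "v \<in> pcarrier (fobj W i)"
      using that(2) by (auto simp: is_poset_def partial_order_on_def preorder_on_def)
  qed
  have W_app: "pfun (farr W d) u \<in> pcarrier (fobj W j)"
    if "d \<in> hom S i j" "u \<in> pcarrier (fobj W i)" for d i j u
    using W.farr_hom[OF that(1)] that(2) by (auto simp: Pos_def hom_def is_pmap_def)
  have cone_image: "weighted_cone X S (P \<circ>\<^sub>F D) W (fobj P b) (\<lambda>i u. farr P (\<beta> i u))"
    if "weighted_cone A S D W b \<beta>" for b \<beta>
    unfolding weighted_cone_def
  proof (intro conjI ballI allI impI)
    show "fobj P b \<in> Obj X"
      using that fobj_obj by (simp add: weighted_cone_def)
    show "farr P (\<beta> i u) \<in> hom X (fobj P b) (fobj (P \<circ>\<^sub>F D) i)"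
      if "i \<in> Obj S" "u \<in> pcarrier (fobj W i)" for i u
      using \<open>weighted_cone A S D W b \<beta>\<close> that farr_hom by (simp add: weighted_cone_def fcomp_def)
    show "farr P (\<beta> i u) \<sqsubseteq>\<^bsub>X\<^esub> farr P (\<beta> i v)"
      if "i \<in> Obj S" "(u, v) \<in> prel (fobj W i)" for i u v
    proof (rule farr_mono)
      show "\<beta> i u \<in> hom A b (fobj D i)" "\<beta> i v \<in> hom A b (fobj D i)" "\<beta> i u \<sqsubseteq>\<^bsub>A\<^esub> \<beta> i v"
        using \<open>weighted_cone A S D W b \<beta>\<close> that carrier[OF that] unfolding weighted_cone_def by blast+
    qed
    show "farr (P \<circ>\<^sub>F D) d \<cdot>\<^bsub>X\<^esub> farr P (\<beta> i u) = farr P (\<beta> j (pfun (farr W d) u))"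
      if "i \<in> Obj S" "j \<in> Obj S" "d \<in> hom S i j" "u \<in> pcarrier (fobj W i)" for i j d u
    proof -
      have \<beta>iu: "\<beta> i u \<in> hom A b (fobj D i)" and "farr D d \<cdot>\<^bsub>A\<^esub> \<beta> i u = \<beta> j (pfun (farr W d) u)"
        using \<open>weighted_cone A S D W b \<beta>\<close> that by (auto simp: weighted_cone_def)
      then show ?thesis
        using farr_comp[OF \<beta>iu D.farr_hom[OF that(3)]] by (simp add: fcomp_def)
    qed
  qed
  define Q where "Q = {(b, g). b \<in> Obj A \<and> g \<in> hom X (fobj P b) l \<and>
      (\<exists>\<beta>. weighted_cone A S D W b \<beta> \<and>
        (\<forall>i \<in> Obj S. \<forall>u \<in> pcarrier (fobj W i). farr P (\<beta> i u) = \<mu>X i u \<cdot>\<^bsub>X\<^esub> g))}"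
  obtain k \<alpha> q where "solid_lift A X P l Q fst snd k \<alpha> q"
    using pair_indexed_lift[OF inf sos l, of Q fst snd] by (auto simp: Q_def)
  then have k: "k \<in> Obj A"
    and \<alpha>: "\<And>b g. (b, g) \<in> Q \<Longrightarrow> \<alpha> (b, g) \<in> hom A b k"
    and q: "q \<in> hom X l (fobj P k)"
    and P\<alpha>: "\<And>b g. (b, g) \<in> Q \<Longrightarrow> farr P (\<alpha> (b, g)) = q \<cdot>\<^bsub>X\<^esub> g"
    and univ: "\<And>b \<beta> f. b \<in> Obj A \<Longrightarrow> \<forall>j\<in>Q. \<beta> j \<in> hom A (fst j) b \<Longrightarrow> f \<in> hom X l (fobj P b) \<Longrightarrow>
        \<forall>j\<in>Q. farr P (\<beta> j) = f \<cdot>\<^bsub>X\<^esub> snd j \<Longrightarrow>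
        \<exists>!t. t \<in> hom A k b \<and> (\<forall>j\<in>Q. t \<cdot>\<^bsub>A\<^esub> \<alpha> j = \<beta> j) \<and> farr P t \<cdot>\<^bsub>X\<^esub> q = f"
    and epic: "order_P_epic A X P k q"
    unfolding solid_lift_def by auto
  \<comment> \<open>The components at \<open>(i, u)\<close> of the cones belonging to the indices in \<open>Q\<close> form a family of
      morphisms into \<open>D i\<close>, which extends along the lift.\<close>
  have "\<exists>t. t \<in> hom A k (fobj D i) \<and> farr P t \<cdot>\<^bsub>X\<^esub> q = \<mu>X i u"
    if iu: "i \<in> Obj S" "u \<in> pcarrier (fobj W i)" for i u
  proof -
    have "\<forall>j\<in>Q. \<exists>m. m \<in> hom A (fst j) (fobj D i) \<and> farr P m = \<mu>X i u \<cdot>\<^bsub>X\<^esub> snd j"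
      using iu unfolding Q_def weighted_cone_def by fastforce
    then obtain \<beta> where "\<forall>j\<in>Q. \<beta> j \<in> hom A (fst j) (fobj D i) \<and> farr P (\<beta> j) = \<mu>X i u \<cdot>\<^bsub>X\<^esub> snd j"
      by metis
    then show ?thesis
      using univ[OF D.fobj_obj[OF iu(1)], of \<beta> "\<mu>X i u"] \<mu>X_hom[OF iu] by blast
  qed
  then obtain \<mu> where \<mu>_hom: "\<And>i u. i \<in> Obj S \<Longrightarrow> u \<in> pcarrier (fobj W i) \<Longrightarrow> \<mu> i u \<in> hom A k (fobj D i)"
    and P\<mu>: "\<And>i u. i \<in> Obj S \<Longrightarrow> u \<in> pcarrier (fobj W i) \<Longrightarrow> farr P (\<mu> i u) \<cdot>\<^bsub>X\<^esub> q = \<mu>X i u"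
    by metis
  have cone: "weighted_cone A S D W k \<mu>"
    unfolding weighted_cone_def
  proof (intro conjI ballI allI impI)
    show "k \<in> Obj A" by (fact k)
    show "\<mu> i u \<in> hom A k (fobj D i)" if "i \<in> Obj S" "u \<in> pcarrier (fobj W i)" for i u
      using that by (rule \<mu>_hom)
    show "\<mu> i u \<sqsubseteq>\<^bsub>A\<^esub> \<mu> i v" if "i \<in> Obj S" "(u, v) \<in> prel (fobj W i)" for i u v
      using carrier[OF that] that epic_le[OF epic \<mu>_hom \<mu>_hom] P\<mu> \<mu>X_mono by simp
    show "farr D d \<cdot>\<^bsub>A\<^esub> \<mu> i u = \<mu> j (pfun (farr W d) u)"
      if "i \<in> Obj S" "j \<in> Obj S" "d \<in> hom S i j" "u \<in> pcarrier (fobj W i)" for i j d u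
    proof (rule epic_eq[OF epic q])
      note Dd = D.farr_hom[OF that(3)] and \<mu>iu = \<mu>_hom[OF that(1,4)]
      show "farr D d \<cdot>\<^bsub>A\<^esub> \<mu> i u \<in> hom A k (fobj D j)"
        using source.comp_hom[OF \<mu>iu Dd] .
      show "\<mu> j (pfun (farr W d) u) \<in> hom A k (fobj D j)"
        using \<mu>_hom[OF that(2) W_app[OF that(3,4)]] .
      show "farr P (farr D d \<cdot>\<^bsub>A\<^esub> \<mu> i u) \<cdot>\<^bsub>X\<^esub> q = farr P (\<mu> j (pfun (farr W d) u)) \<cdot>\<^bsub>X\<^esub> q"
        using farr_comp_assoc[OF q \<mu>iu Dd] P\<mu>[OF that(1,4)] P\<mu>[OF that(2) W_app[OF that(3,4)]]
          \<mu>X_nat[OF that] by simp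
    qed
  qed
  obtain p where p: "p \<in> hom X (fobj P k) l"
    and \<mu>X_p: "\<And>i u. i \<in> Obj S \<Longrightarrow> u \<in> pcarrier (fobj W i) \<Longrightarrow> farr P (\<mu> i u) = \<mu>X i u \<cdot>\<^bsub>X\<^esub> p"
    using lim_ex[OF cone_image[OF cone]] by blast
  have pq: "p \<cdot>\<^bsub>X\<^esub> q = Id X l"
  proof (rule lim_eq[OF target.comp_hom[OF q p] target.id_hom[OF l]])
    show "\<mu>X i u \<cdot>\<^bsub>X\<^esub> (p \<cdot>\<^bsub>X\<^esub> q) = \<mu>X i u \<cdot>\<^bsub>X\<^esub> Id X l"
      if "i \<in> Obj S" "u \<in> pcarrier (fobj W i)" for i u
      using target.comp_assoc[OF q p \<mu>X_hom[OF that]] \<mu>X_p[OF that] P\<mu>[OF that]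
        target.comp_id[OF \<mu>X_hom[OF that]] by simp
  qed
  have kp: "(k, p) \<in> Q"
    using k p cone \<mu>X_p by (auto simp: Q_def)
  \<comment> \<open>Since \<open>P (\<alpha> (k, p)) \<cdot> q = q \<cdot> p \<cdot> q = q\<close>, the lifted morphism is the identity.\<close>
  have "\<alpha> (k, p) = Id A k"
  proof (rule epic_eq[OF epic q \<alpha>[OF kp] source.id_hom[OF k]])
    show "farr P (\<alpha> (k, p)) \<cdot>\<^bsub>X\<^esub> q = farr P (Id A k) \<cdot>\<^bsub>X\<^esub> q"
      using P\<alpha>[OF kp] target.comp_assoc[OF q p q] pq target.comp_id[OF q] target.id_comp[OF q]
        farr_id[OF k] by simp
  qed
  then have qp: "q \<cdot>\<^bsub>X\<^esub> p = Id X (fobj P k)"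
    using P\<alpha>[OF kp] farr_id[OF k] by simp
  have joint_le: "r \<sqsubseteq>\<^bsub>A\<^esub> s"
    if r: "r \<in> hom A b k" and s: "s \<in> hom A b k"
      and le: "\<And>i u. i \<in> Obj S \<Longrightarrow> u \<in> pcarrier (fobj W i) \<Longrightarrow> \<mu> i u \<cdot>\<^bsub>A\<^esub> r \<sqsubseteq>\<^bsub>A\<^esub> \<mu> i u \<cdot>\<^bsub>A\<^esub> s" for b r s
  proof (rule faithful_le[OF faithful r s])
    have hom: "p \<cdot>\<^bsub>X\<^esub> farr P g \<in> hom X (fobj P b) l" if "g \<in> hom A b k" for g
      using target.comp_hom[OF farr_hom[OF that] p] .
    have factor: "farr P (\<mu> i u \<cdot>\<^bsub>A\<^esub> g) = \<mu>X i u \<cdot>\<^bsub>X\<^esub> (p \<cdot>\<^bsub>X\<^esub> farr P g)"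
      if "g \<in> hom A b k" "i \<in> Obj S" "u \<in> pcarrier (fobj W i)" for g i u
      using farr_comp[OF that(1) \<mu>_hom[OF that(2,3)]] \<mu>X_p[OF that(2,3)]
        target.comp_assoc[OF farr_hom[OF that(1)] p \<mu>X_hom[OF that(2,3)]] by simp
    have "p \<cdot>\<^bsub>X\<^esub> farr P r \<sqsubseteq>\<^bsub>X\<^esub> p \<cdot>\<^bsub>X\<^esub> farr P s"
    proof (rule lim_le[OF hom[OF r] hom[OF s]])
      fix i u assume iu: "i \<in> Obj S" "u \<in> pcarrier (fobj W i)"
      have "farr P (\<mu> i u \<cdot>\<^bsub>A\<^esub> r) \<sqsubseteq>\<^bsub>X\<^esub> farr P (\<mu> i u \<cdot>\<^bsub>A\<^esub> s)"
        using farr_mono[OF source.comp_hom[OF r \<mu>_hom[OF iu]] source.comp_hom[OF s \<mu>_hom[OF iu]]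
            le[OF iu]] .
      then show "\<mu>X i u \<cdot>\<^bsub>X\<^esub> (p \<cdot>\<^bsub>X\<^esub> farr P r) \<sqsubseteq>\<^bsub>X\<^esub> \<mu>X i u \<cdot>\<^bsub>X\<^esub> (p \<cdot>\<^bsub>X\<^esub> farr P s)"
        using factor[OF r iu] factor[OF s iu] by simp
    qed
    then have "q \<cdot>\<^bsub>X\<^esub> (p \<cdot>\<^bsub>X\<^esub> farr P r) \<sqsubseteq>\<^bsub>X\<^esub> q \<cdot>\<^bsub>X\<^esub> (p \<cdot>\<^bsub>X\<^esub> farr P s)"
      using target.comp_mono_left[OF hom[OF r] hom[OF s] q] by blast
    moreover have "q \<cdot>\<^bsub>X\<^esub> (p \<cdot>\<^bsub>X\<^esub> farr P g) = farr P g" if "g \<in> hom A b k" for g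
      using target.comp_assoc[OF farr_hom[OF that] p q] qp target.id_comp[OF farr_hom[OF that]]
      by simp
    ultimately show "farr P r \<sqsubseteq>\<^bsub>X\<^esub> farr P s"
      using r s by simp
  qed
  have factorization: "\<exists>!t. t \<in> hom A b k \<and>
      (\<forall>i \<in> Obj S. \<forall>u \<in> pcarrier (fobj W i). \<beta> i u = \<mu> i u \<cdot>\<^bsub>A\<^esub> t)"
    if \<beta>: "weighted_cone A S D W b \<beta>" for b \<beta>
  proof (rule ex_ex1I)
    have b: "b \<in> Obj A"
      and \<beta>_hom: "\<And>i u. i \<in> Obj S \<Longrightarrow> u \<in> pcarrier (fobj W i) \<Longrightarrow> \<beta> i u \<in> hom A b (fobj D i)"
      using \<beta> by (auto simp: weighted_cone_def)
    obtain g where g: "g \<in> hom X (fobj P b) l"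
      and P\<beta>: "\<And>i u. i \<in> Obj S \<Longrightarrow> u \<in> pcarrier (fobj W i) \<Longrightarrow> farr P (\<beta> i u) = \<mu>X i u \<cdot>\<^bsub>X\<^esub> g"
      using lim_ex[OF cone_image[OF \<beta>]] by blast
    have bg: "(b, g) \<in> Q"
      using b g \<beta> P\<beta> by (auto simp: Q_def)
    have "\<beta> i u = \<mu> i u \<cdot>\<^bsub>A\<^esub> \<alpha> (b, g)" if iu: "i \<in> Obj S" "u \<in> pcarrier (fobj W i)" for i u
    proof (rule faithful_eq[OF faithful \<beta>_hom[OF iu] source.comp_hom[OF \<alpha>[OF bg] \<mu>_hom[OF iu]]])
      show "farr P (\<beta> i u) = farr P (\<mu> i u \<cdot>\<^bsub>A\<^esub> \<alpha> (b, g))"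
        using farr_comp[OF \<alpha>[OF bg] \<mu>_hom[OF iu]] P\<alpha>[OF bg] P\<beta>[OF iu] P\<mu>[OF iu]
          target.comp_assoc[OF g q farr_hom[OF \<mu>_hom[OF iu]]] by simp
    qed
    then show "\<exists>t. t \<in> hom A b k \<and>
        (\<forall>i \<in> Obj S. \<forall>u \<in> pcarrier (fobj W i). \<beta> i u = \<mu> i u \<cdot>\<^bsub>A\<^esub> t)"
      using \<alpha>[OF bg] by blast
  next
    fix r s
    assume r: "r \<in> hom A b k \<and> (\<forall>i \<in> Obj S. \<forall>u \<in> pcarrier (fobj W i). \<beta> i u = \<mu> i u \<cdot>\<^bsub>A\<^esub> r)"
      and s: "s \<in> hom A b k \<and> (\<forall>i \<in> Obj S. \<forall>u \<in> pcarrier (fobj W i). \<beta> i u = \<mu> i u \<cdot>\<^bsub>A\<^esub> s)"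
    have \<beta>_le: "\<beta> i u \<sqsubseteq>\<^bsub>A\<^esub> \<beta> i u" if "i \<in> Obj S" "u \<in> pcarrier (fobj W i)" for i u
      using \<beta> that source.le_refl unfolding weighted_cone_def by blast
    have "\<mu> i u \<cdot>\<^bsub>A\<^esub> r \<sqsubseteq>\<^bsub>A\<^esub> \<mu> i u \<cdot>\<^bsub>A\<^esub> s" "\<mu> i u \<cdot>\<^bsub>A\<^esub> s \<sqsubseteq>\<^bsub>A\<^esub> \<mu> i u \<cdot>\<^bsub>A\<^esub> r"
      if "i \<in> Obj S" "u \<in> pcarrier (fobj W i)" for i u
      using \<beta>_le[OF that] r s that by simp_all
    then show "r = s"
      using source.le_antisym[of r b k s] joint_le[of r b s] joint_le[of s b r] r s by blast
  qed
  have "weighted_limit A S D W k \<mu>"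
    unfolding weighted_limit_def using cone factorization joint_le by blast
  then show "\<exists>l \<mu>. weighted_limit A S D W l \<mu>" by blast
qed

theorem theorem4p5:
  fixes A X :: "('u, 'u) ocat"
    and P :: "('u, 'u, 'u, 'u) ofun"
  assumes "infinite (UNIV :: 'u set)"
    and "ordered_functor A X P"
  shows "(strongly_order_solid A X P \<longleftrightarrow> order_solid A X P \<and> order_faithful A X P)
    \<and> (strongly_order_solid A X P \<longrightarrow>
        (\<forall>S :: ('u, 'u) ocat. ordered_category S \<longrightarrow>
           has_weighted_limits X S \<longrightarrow> has_weighted_limits A S))"
proof -
  interpret class_functor A X P
    using assms(2) by (rule class_functor.intro)
  show ?thesis
    using assms(1) strongly_order_solid_imp_order_faithful strongly_order_solid_imp_order_solid
      order_solid_faithful_imp_strongly_order_solid strongly_order_solid_lifts_weighted_limits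
    by blast
qed

end
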